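(* Let $(\langle G,m\rangle,p)$ be a framework that is minimally rigid on the $x$-variable torus $\mathcal T_x^2$. Then the edge set of $G$ is the disjoint union of the edge sets of a spanning tree of $G$ and a connected spanning map-graph of $G$.
   Context: A periodic orbit graph $\langle G,m\rangle$ is a finite directed multigraph $G=(V,E)$ (loops, parallel edges allowed) with gains $m:E\to\mathbb Z^2$; $\{v_i,v_j;m_e\}$ is an edge from $v_i$ to $v_j$ with gain $m_e$. Fix reals $y_1,y_2$, $L_x=\begin{pmatrix}x&0\\ y_1&y_2\end{pmatrix}$. For $p:V\to\mathbb R^2$, $\mathcal R_x(\langle G,m\rangle,p)$ is the $|E|\times(2|V|+1)$ matrix whose row for $e=\{v_i,v_j;m_e\}$ has $p_i-(p_j+m_eL_x)$ in the columns of $v_i$, $(p_j+m_eL_x)-p_i$ in the columns of $v_j$ (added if $i=j$), zeros in other vertex columns, and $(m_e)_x[p_i-(p_j+m_eL_x)]_x$ in the last column ($(\cdot)_x$ = first coordinate). The framework is minimally rigid on $\mathcal T_x^2$ if $|E|=2|V|-1$ and $\mathcal R_x$ has rank $2|V|-1$. A map-graph is a graph each of whose connected components contains exactly one cycle (a loop counts as a cycle). *)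

theory Defs
  imports "HOL-Analysis.Analysis" "Graph_Theory.Graph_Theory"
begin

text \<open>
  The orbit graph is a multi-digraph of the \<^typ>\<open>('v, 'e) pre_digraph\<close> kind, but trees, components
  and cycles refer to its underlying undirected multigraph. The notions \<^const>\<open>tree\<close>,
  \<^const>\<open>spanning_tree\<close> and \<^const>\<open>pre_digraph.cycle\<close> of the graph library are about directed
  cycles, so undirected versions are introduced here. (\<^const>\<open>Digraph_Component.connected\<close> and
  \<^const>\<open>spanning\<close> are the right notions already.)
\<close>

definition joins :: "('v, 'e) pre_digraph \<Rightarrow> 'e \<Rightarrow> 'v \<Rightarrow> 'v \<Rightarrow> bool" where
  "joins G e u v \<longleftrightarrow> tail G e = u \<and> head G e = v \<or> tail G e = v \<and> head G e = u"

text \<open>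
  Cycles are identified with their edge sets, so that cyclic shifts and reversal of the traversal
  do not count as different cycles. A loop is a cycle of length 1, two parallel or antiparallel
  edges form a cycle of length 2.
\<close>
definition undirected_cycle :: "('v, 'e) pre_digraph \<Rightarrow> 'e set \<Rightarrow> bool" where
  "undirected_cycle G C \<longleftrightarrow>
     (\<exists>vs es. es \<noteq> [] \<and> length vs = length es \<and> distinct vs \<and> distinct es \<and>
        set vs \<subseteq> verts G \<and> set es \<subseteq> arcs G \<and>
        (\<forall>i < length es. joins G (es ! i) (vs ! i) (vs ! (Suc i mod length es))) \<and>
        C = set es)"

definition undirected_tree :: "('v, 'e) pre_digraph \<Rightarrow> bool" where
  "undirected_tree G \<longleftrightarrow> Digraph_Component.connected G \<and> \<not> (\<exists>C. undirected_cycle G C)"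

definition conn_components :: "('v, 'e) pre_digraph \<Rightarrow> ('v, 'e) pre_digraph set" where
  "conn_components G =
     {H. induced_subgraph H G \<and> Digraph_Component.connected H \<and>
         \<not> (\<exists>H'. induced_subgraph H' G \<and> Digraph_Component.connected H' \<and> verts H \<subset> verts H')}"

definition map_graph :: "('v, 'e) pre_digraph \<Rightarrow> bool" where
  "map_graph G \<longleftrightarrow> (\<forall>H \<in> conn_components G. \<exists>!C. undirected_cycle H C)"

definition lattice_matrix :: "real \<Rightarrow> real \<Rightarrow> real \<Rightarrow> real^2^2" where
  "lattice_matrix y1 y2 x = vector [vector [x, 0], vector [y1, y2]]"

text \<open>The edge vector \<open>p\<^sub>i - (p\<^sub>j + m\<^sub>e L\<^sub>x)\<close>; the gain acts as a row vector.\<close>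
definition edge_vector ::
  "real \<Rightarrow> real \<Rightarrow> real \<Rightarrow> ('v, 'e) pre_digraph \<Rightarrow> ('e \<Rightarrow> int^2) \<Rightarrow> ('v \<Rightarrow> real^2) \<Rightarrow> 'e \<Rightarrow> real^2" where
  "edge_vector y1 y2 x G m p e =
     p (tail G e) - (p (head G e) + (\<chi> k. real_of_int (m e $ k)) v* lattice_matrix y1 y2 x)"

text \<open>
  The column \<open>Inl (v, k)\<close> belongs to the \<open>k\<close>-th coordinate of the vertex \<open>v\<close>, and \<open>Inr ()\<close> is the
  last column. The types \<open>'v\<close> and \<open>'e\<close> are meant to be exactly the vertices and the edges of \<open>G\<close>.
\<close>
definition rigidity_matrix ::
  "real \<Rightarrow> real \<Rightarrow> real \<Rightarrow> ('v::finite, 'e::finite) pre_digraph \<Rightarrow> ('e \<Rightarrow> int^2) \<Rightarrow> ('v \<Rightarrow> real^2)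
     \<Rightarrow> real ^ (('v \<times> 2) + unit) ^ 'e" where
  "rigidity_matrix y1 y2 x G m p = (\<chi> e c. let d = edge_vector y1 y2 x G m p e in
     case c of
       Inl (v, k) \<Rightarrow> (if v = tail G e then d $ k else 0) + (if v = head G e then - d $ k else 0)
     | Inr _ \<Rightarrow> real_of_int (m e $ 1) * d $ 1)"

definition minimally_rigid_x ::
  "real \<Rightarrow> real \<Rightarrow> real \<Rightarrow> ('v::finite, 'e::finite) pre_digraph \<Rightarrow> ('e \<Rightarrow> int^2) \<Rightarrow> ('v \<Rightarrow> real^2)
     \<Rightarrow> bool" where
  "minimally_rigid_x y1 y2 x G m p \<longleftrightarrow>
     card (arcs G) = 2 * card (verts G) - 1 \<and>
     rank (rigidity_matrix y1 y2 x G m p) = 2 * card (verts G) - 1"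

end

theory Submission
  imports Defs
begin

text \<open>
  Split every row of the rigidity matrix into its part in the columns of the second coordinates and
  the rest. The rows are independent, so one part of each row can be kept such that the rows stay
  independent; let \<open>T\<close> be the edges keeping the second-coordinate part and \<open>M\<close> the others. The
  \<open>2n - 1\<close> new rows have a two-dimensional orthogonal complement in dimension \<open>2n + 1\<close>, so it consists
  of the translations only. A potential that is constant along the edges of \<open>T\<close> (or of \<open>M\<close>), placed in
  the second (or first) coordinates, is orthogonal to all new rows and hence constant: both \<open>T\<close> and \<open>M\<close>
  are connected and spanning. Independence makes every edge of \<open>T\<close> a bridge, so \<open>T\<close> has \<open>n - 1\<close> edges
  and \<open>M\<close> has \<open>n\<close>, and these counts force \<open>T\<close> to be a tree and \<open>M\<close> to have exactly one cycle.
\<close>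

section \<open>Independent families\<close>

text \<open>Independence of an image set ignores repetitions; carrying injectivity along makes it
  independence of an indexed family.\<close>

lemma independent_family_insert:
  fixes w :: "'a \<Rightarrow> 'b::real_vector"
  assumes "e \<notin> A"
  shows "inj_on w (insert e A) \<and> independent (w ` insert e A) \<longleftrightarrow>
    inj_on w A \<and> independent (w ` A) \<and> w e \<notin> span (w ` A)"
proof -
  have "w e \<in> w ` A \<Longrightarrow> w e \<in> span (w ` A)"
    by (rule span_base)
  then show ?thesis
    using assms by (auto simp: independent_insert)
qed

lemma independent_family_iff:
  fixes w :: "'a \<Rightarrow> 'b::real_vector"
  shows "inj_on w A \<and> independent (w ` A) \<longleftrightarrow> (\<forall>e\<in>A. w e \<notin> span (w ` (A - {e})))"
proof (intro iffI ballI)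
  fix e assume "inj_on w A \<and> independent (w ` A)" "e \<in> A"
  then show "w e \<notin> span (w ` (A - {e}))"
    using independent_family_insert[of e "A - {e}" w] by (simp add: insert_absorb)
next
  assume *: "\<forall>e\<in>A. w e \<notin> span (w ` (A - {e}))"
  have inj: "inj_on w A"
  proof (rule inj_onI, rule ccontr)
    fix a b assume "a \<in> A" "b \<in> A" "w a = w b" "a \<noteq> b"
    then have "w a \<in> span (w ` (A - {a}))" by (intro span_base) auto
    with * \<open>a \<in> A\<close> show False by blast
  qed
  moreover have "independent (w ` A)"
    unfolding dependent_def
  proof (clarsimp)
    fix e assume "e \<in> A" "w e \<in> span (w ` A - {w e})"
    moreover have "w ` A - {w e} = w ` (A - {e})"
      using inj \<open>e \<in> A\<close> by (auto simp: inj_on_def)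
    ultimately show False using * by simp
  qed
  ultimately show "inj_on w A \<and> independent (w ` A)" by simp
qed

text \<open>
  This replaces the Laplace expansion of a determinant along two blocks of columns: summands are
  chosen one vector at a time, since if both \<open>u e\<close> and \<open>v e\<close> lay in the span of the other vectors,
  so would their sum.
\<close>
lemma independent_family_choose_summand:
  fixes u v :: "'a \<Rightarrow> 'b::real_vector"
  assumes "finite A" "inj_on (\<lambda>e. u e + v e) A" "independent ((\<lambda>e. u e + v e) ` A)"
  obtains S where "S \<subseteq> A" "inj_on (\<lambda>e. if e \<in> S then u e else v e) A"
    "independent ((\<lambda>e. if e \<in> S then u e else v e) ` A)"
proof -
  \<comment> \<open>Hybrid family for the induction: indices in \<open>F\<close> are decided, those
    in \<open>S\<close> in favour of \<open>u\<close>; all others still carry the full sum.\<close>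
  define w where "w F S e = (if e \<in> F then if e \<in> S then u e else v e else u e + v e)" for F S e
  have "\<exists>S\<subseteq>F. inj_on (w F S) A \<and> independent (w F S ` A)" if "F \<subseteq> A" for F
    using finite_subset[OF that \<open>finite A\<close>] that
  proof (induction F rule: finite_induct)
    case empty
    show ?case using assms by (simp add: w_def[abs_def])
  next
    case (insert f F)
    then obtain S where S: "S \<subseteq> F" "inj_on (w F S) A" "independent (w F S ` A)" by auto
    let ?B = "A - {f}"
    have A: "insert f ?B = A" "f \<notin> ?B" using insert.prems by auto
    have fS: "f \<notin> S" using S insert.hyps by auto
    have B: "inj_on (w F S) ?B" "independent (w F S ` ?B)" "w F S f \<notin> span (w F S ` ?B)"
      using independent_family_insert[OF A(2), of "w F S"] S(2,3) unfolding A(1) by blast+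
    have agree: "w (insert f F) S e = w F S e" "w (insert f F) (insert f S) e = w F S e" if "e \<in> ?B" for e
      using that by (auto simp: w_def)
    have img: "w (insert f F) S ` ?B = w F S ` ?B" "w (insert f F) (insert f S) ` ?B = w F S ` ?B"
      using agree by (auto intro!: image_cong)
    have inj: "inj_on (w (insert f F) S) ?B" "inj_on (w (insert f F) (insert f S)) ?B"
      using B(1) agree unfolding inj_on_def by metis+
    have "w F S f = u f + v f" using insert.hyps by (simp add: w_def)
    then consider "u f \<notin> span (w F S ` ?B)" | "v f \<notin> span (w F S ` ?B)"
      using B(3) span_add by metis
    then show ?case
    proof cases
      case 1
      then have "w (insert f F) (insert f S) f \<notin> span (w (insert f F) (insert f S) ` ?B)"
        by (simp only: img) (simp add: w_def)
      then have "inj_on (w (insert f F) (insert f S)) A \<and> independent (w (insert f F) (insert f S) ` A)"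
        using independent_family_insert[OF A(2), of "w (insert f F) (insert f S)"] B(2) inj
        unfolding A(1) img by blast
      then show ?thesis using S(1) by (intro exI[of _ "insert f S"]) auto
    next
      case 2
      then have "w (insert f F) S f \<notin> span (w (insert f F) S ` ?B)"
        by (simp only: img) (simp add: w_def fS)
      then have "inj_on (w (insert f F) S) A \<and> independent (w (insert f F) S ` A)"
        using independent_family_insert[OF A(2), of "w (insert f F) S"] B(2) inj
        unfolding A(1) img by blast
      then show ?thesis using S(1) by (intro exI[of _ S]) auto
    qed
  qed
  from this[of A] obtain S where S: "S \<subseteq> A" "inj_on (w A S) A" "independent (w A S ` A)" by auto
  have "w A S e = (if e \<in> S then u e else v e)" if "e \<in> A" for e
    using that by (simp add: w_def)
  with S show ?thesis
    using that[of S] by (simp cong: inj_on_cong image_cong_simp)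
qed

text \<open>Take for \<open>z\<close> the component of \<open>a\<close> orthogonal to
  \<open>span B\<close>; then \<open>a \<bullet> z = z \<bullet> z\<close>, which is
  nonzero.\<close>

lemma exists_orthogonal_if_notin_span:
  fixes a :: "'a::euclidean_space"
  assumes "a \<notin> span B"
  obtains z where "\<And>b. b \<in> B \<Longrightarrow> b \<bullet> z = 0" "a \<bullet> z \<noteq> 0"
proof -
  obtain y z where yz: "y \<in> span B" "\<And>w. w \<in> span B \<Longrightarrow> orthogonal z w" "a = y + z"
    using orthogonal_subspace_decomp_exists by blast
  have "z \<noteq> 0" using yz assms by auto
  moreover have "y \<bullet> z = 0"
    using yz by (metis orthogonal_def inner_commute)
  ultimately have "a \<bullet> z \<noteq> 0"
    using yz(3) by (simp add: inner_add_left)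
  moreover have "b \<bullet> z = 0" if "b \<in> B" for b
    using yz(2)[OF span_base[OF that]] by (simp add: orthogonal_def inner_commute)
  ultimately show ?thesis using that by blast
qed

lemma dim_orthogonal_to_set:
  fixes B :: "'a::euclidean_space set"
  shows "dim {z. \<forall>b\<in>B. b \<bullet> z = 0} + dim B = DIM('a)"
proof -
  have "{z. \<forall>b\<in>B. b \<bullet> z = 0} = {z \<in> UNIV. \<forall>b\<in>span B. orthogonal b z}"
  proof (intro set_eqI iffI; clarsimp)
    fix z b assume "\<forall>b\<in>B. b \<bullet> z = 0" "b \<in> span B"
    then have "orthogonal z b"
      by (intro orthogonal_to_span[of b B]) (simp_all add: orthogonal_def inner_commute[of z])
    then show "orthogonal b z"
      by (simp add: orthogonal_commute)
  next
    fix z b assume "\<forall>b\<in>span B. orthogonal b z" "b \<in> B"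
    then show "b \<bullet> z = 0"
      using span_base[of b B] by (simp add: orthogonal_def)
  qed
  then show ?thesis
    using dim_subspace_orthogonal_to_vectors[of "span B" UNIV] by simp
qed

section \<open>Connectivity through potentials\<close>

definition locally_constant :: "('v, 'e) pre_digraph \<Rightarrow> 'e set \<Rightarrow> ('v \<Rightarrow> real) \<Rightarrow> bool" where
  "locally_constant G A \<phi> \<longleftrightarrow> (\<forall>e\<in>A. \<phi> (tail G e) = \<phi> (head G e))"

text \<open>Being joined by a path, phrased through potentials so that it dualises to linear algebra.\<close>
definition linked :: "('v, 'e) pre_digraph \<Rightarrow> 'e set \<Rightarrow> 'v \<Rightarrow> 'v \<Rightarrow> bool" where
  "linked G A u v \<longleftrightarrow> (\<forall>\<phi>. locally_constant G A \<phi> \<longrightarrow> \<phi> u = \<phi> v)"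

definition all_linked :: "('v, 'e) pre_digraph \<Rightarrow> 'e set \<Rightarrow> bool" where
  "all_linked G A \<longleftrightarrow> (\<forall>u v. linked G A u v)"

lemma all_linkedD: "all_linked G A \<Longrightarrow> locally_constant G A \<phi> \<Longrightarrow> \<phi> u = \<phi> v"
  by (auto simp: all_linked_def linked_def)

definition adjacency :: "('v, 'e) pre_digraph \<Rightarrow> 'e set \<Rightarrow> ('v \<times> 'v) set" where
  "adjacency G A = {(a, b). \<exists>e\<in>A. joins G e a b}"

text \<open>The indicator function of the vertices reachable from \<open>u\<close> is constant along
  \<open>A\<close>, so it has the value 1 at \<open>v\<close> too.\<close>

lemma linked_imp_rtrancl:
  assumes "linked G A u v"
  shows "(u, v) \<in> (adjacency G A)\<^sup>*"
proof -
  let ?R = "(adjacency G A)\<^sup>*"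
  let ?\<phi> = "\<lambda>w. if (u, w) \<in> ?R then 1 else 0 :: real"
  have "(u, tail G e) \<in> ?R \<longleftrightarrow> (u, head G e) \<in> ?R" if "e \<in> A" for e
  proof -
    have "(tail G e, head G e) \<in> adjacency G A" "(head G e, tail G e) \<in> adjacency G A"
      using that by (auto simp: adjacency_def joins_def)
    then show ?thesis by (meson rtrancl.rtrancl_into_rtrancl)
  qed
  then have "locally_constant G A ?\<phi>"
    by (simp add: locally_constant_def)
  then have "?\<phi> u = ?\<phi> v"
    using assms unfolding linked_def by blast
  then show ?thesis by (simp split: if_splits)
qed

lemma all_linked_imp_connected:
  assumes "all_linked G A" "verts G = UNIV"
  shows "Digraph_Component.connected (G\<lparr>arcs := A\<rparr>)"
proof -
  have "(u, v) \<in> rtrancl_on UNIV (parcs (mk_symmetric (G\<lparr>arcs := A\<rparr>)))" for u v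
  proof -
    have "adjacency G A \<subseteq> parcs (mk_symmetric (G\<lparr>arcs := A\<rparr>))"
      by (fastforce simp: adjacency_def joins_def parcs_mk_symmetric)
    moreover have "(u, v) \<in> (adjacency G A)\<^sup>*"
      using assms by (intro linked_imp_rtrancl) (simp add: all_linked_def)
    ultimately have "(u, v) \<in> (parcs (mk_symmetric (G\<lparr>arcs := A\<rparr>)))\<^sup>*"
      using rtrancl_mono by blast
    then show ?thesis
      by (induction rule: rtrancl_induct) (auto intro: rtrancl_on_into_rtrancl_on)
  qed
  then show ?thesis
    using assms(2) by (simp add: Digraph_Component.connected_def strongly_connected_def reachable_def)
qed

section \<open>Cycles\<close>

lemma undirected_cycle_nonempty: "undirected_cycle G C \<Longrightarrow> C \<noteq> {}"
  unfolding undirected_cycle_def by auto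

lemma undirected_cycle_subset: "undirected_cycle G C \<Longrightarrow> C \<subseteq> arcs G"
  unfolding undirected_cycle_def by blast

text \<open>A walk is kept simple while it grows: on a return to an earlier vertex it is cut back to
  that vertex.\<close>

lemma linked_imp_simple_path:
  assumes "linked G A u v"
  obtains vs es where "length vs = Suc (length es)" "distinct vs" "vs ! 0 = u" "vs ! length es = v"
    "set es \<subseteq> A" "\<forall>i < length es. joins G (es ! i) (vs ! i) (vs ! Suc i)"
proof -
  have "(u, v) \<in> (adjacency G A)\<^sup>*" using assms by (rule linked_imp_rtrancl)
  then have "\<exists>vs es. length vs = Suc (length es) \<and> distinct vs \<and> vs ! 0 = u \<and> vs ! length es = v \<and>
    set es \<subseteq> A \<and> (\<forall>i < length es. joins G (es ! i) (vs ! i) (vs ! Suc i))"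
  proof (induction rule: rtrancl_induct)
    case base
    show ?case by (intro exI[of _ "[u]"] exI[of _ "[]"]) auto
  next
    case (step v w)
    then obtain vs es where p: "length vs = Suc (length es)" "distinct vs" "vs ! 0 = u"
      "vs ! length es = v" "set es \<subseteq> A" "\<forall>i < length es. joins G (es ! i) (vs ! i) (vs ! Suc i)"
      by blast
    obtain e where e: "e \<in> A" "joins G e v w" using step.hyps by (auto simp: adjacency_def)
    show ?case
    proof (cases "w \<in> set vs")
      case True
      then obtain k where k: "k \<le> length es" "vs ! k = w"
        using p(1) by (metis in_set_conv_nth less_Suc_eq_le)
      have "set (take k es) \<subseteq> A" using p(5) by (meson order_trans set_take_subset)
      then show ?thesis using p k
        by (intro exI[of _ "take (Suc k) vs"] exI[of _ "take k es"]) auto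
    next
      case False
      have "joins G ((es @ [e]) ! i) ((vs @ [w]) ! i) ((vs @ [w]) ! Suc i)" if "i < length (es @ [e])" for i
        using that p(1,4,6) e(2) by (cases "i = length es") (auto simp: nth_append)
      then show ?thesis using p e False
        by (intro exI[of _ "vs @ [w]"] exI[of _ "es @ [e]"]) (auto simp: nth_append)
    qed
  qed
  then show ?thesis using that by blast
qed

text \<open>A simple path avoiding \<open>e\<close> is closed up by \<open>e\<close>; if
  \<open>e\<close> is a loop, that path is trivial.\<close>

lemma linked_imp_undirected_cycle:
  assumes "e \<in> A" "linked G (A - {e}) (tail G e) (head G e)" "verts G = UNIV"
  shows "\<exists>C. undirected_cycle (G\<lparr>arcs := A\<rparr>) C"
proof -
  obtain vs es where p: "length vs = Suc (length es)" "distinct vs" "vs ! 0 = tail G e"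
    "vs ! length es = head G e" "set es \<subseteq> A - {e}"
    "\<forall>i < length es. joins G (es ! i) (vs ! i) (vs ! Suc i)"
    using linked_imp_simple_path[OF assms(2)] by blast
  have "distinct es"
  proof (unfold distinct_conv_nth, intro allI impI notI)
    fix i j assume ij: "i < length es" "j < length es" "i \<noteq> j" "es ! i = es ! j"
    have "joins G (es ! i) (vs ! i) (vs ! Suc i)" "joins G (es ! i) (vs ! j) (vs ! Suc j)"
      using ij p(6) by auto
    \<comment> \<open>One edge at two positions would match their end pairs directly or crosswise;
      crosswise needs both \<open>i = Suc j\<close> and \<open>j = Suc i\<close>.\<close>
    then have "vs ! i = vs ! j \<or> vs ! i = vs ! Suc j \<and> vs ! Suc i = vs ! j"
      by (auto simp: joins_def)
    then have "i = j \<or> i = Suc j \<and> Suc i = j"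
      using ij(1,2) p(1,2) by (simp add: nth_eq_iff_index_eq)
    then show False using ij(3) by linarith
  qed
  moreover have "joins G ((es @ [e]) ! i) (vs ! i) (vs ! (Suc i mod length (es @ [e])))"
    if "i < length (es @ [e])" for i
  proof (cases "i = length es")
    case True
    then show ?thesis using p by (simp add: joins_def)
  next
    case False
    then show ?thesis using p(6) that by (simp add: nth_append)
  qed
  ultimately have "undirected_cycle (G\<lparr>arcs := A\<rparr>) (set (es @ [e]))"
    unfolding undirected_cycle_def joins_def using p assms(1,3)
    by (intro exI[of _ vs] exI[of _ "es @ [e]"]) auto
  then show ?thesis by blast
qed

lemma linked_if_in_undirected_cycle:
  assumes "undirected_cycle (G\<lparr>arcs := A\<rparr>) C" "e \<in> C"
  shows "linked G (A - {e}) (tail G e) (head G e)"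
  unfolding linked_def
proof (intro allI impI)
  fix \<phi> assume \<phi>: "locally_constant G (A - {e}) \<phi>"
  obtain vs es where c: "es \<noteq> []" "distinct es" "set es \<subseteq> A" "C = set es"
    and j: "\<And>i. i < length es \<Longrightarrow> joins G (es ! i) (vs ! i) (vs ! (Suc i mod length es))"
    using assms(1) unfolding undirected_cycle_def joins_def by auto
  \<comment> \<open>The differences of \<open>\<phi>\<close> around the cycle sum to \<open>0\<close>, and all but the one at \<open>e\<close> vanish.\<close>
  let ?n = "length es"
  let ?s = "\<lambda>i. Suc i mod ?n"
  obtain k where k: "k < ?n" "es ! k = e" using assms(2) c(4) by (auto simp: in_set_conv_nth)
  have "inj_on ?s {..<?n}"
  proof (rule inj_onI)
    fix i j assume "i \<in> {..<?n}" "j \<in> {..<?n}" "?s i = ?s j"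
    then show "i = j" by (auto simp: mod_Suc split: if_splits)
  qed
  moreover have "?s ` {..<?n} \<subseteq> {..<?n}" using c(1) by auto
  ultimately have "bij_betw ?s {..<?n} {..<?n}"
    by (simp add: bij_betw_def endo_inj_surj)
  then have "(\<Sum>i<?n. \<phi> (vs ! ?s i)) = (\<Sum>i<?n. \<phi> (vs ! i))"
    by (rule sum.reindex_bij_betw)
  then have "(\<Sum>i<?n. \<phi> (vs ! ?s i) - \<phi> (vs ! i)) = 0"
    by (simp add: sum_subtractf)
  moreover have "\<phi> (vs ! ?s i) - \<phi> (vs ! i) = 0" if "i < ?n" "i \<noteq> k" for i
  proof -
    have "es ! i \<noteq> e" using that k c(2) by (auto simp: nth_eq_iff_index_eq)
    then have "es ! i \<in> A - {e}" using that c(3) by auto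
    then have "\<phi> (tail G (es ! i)) = \<phi> (head G (es ! i))"
      using \<phi> unfolding locally_constant_def by blast
    then show ?thesis using j[OF that(1)] by (auto simp: joins_def)
  qed
  ultimately have "\<phi> (vs ! ?s k) - \<phi> (vs ! k) = 0"
    using k(1) by (subst (asm) sum.remove[of _ k]) auto
  then show "\<phi> (tail G e) = \<phi> (head G e)"
    using j[OF k(1)] k(2) by (auto simp: joins_def)
qed

lemma all_linked_Diff_edge:
  assumes "all_linked G A" "linked G (A - {e}) (tail G e) (head G e)"
  shows "all_linked G (A - {e})"
proof -
  have "locally_constant G A \<phi>" if "locally_constant G (A - {e}) \<phi>" for \<phi>
    using that assms(2) unfolding locally_constant_def linked_def by blast
  then show ?thesis using assms(1) by (simp add: all_linked_def linked_def)
qed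

section \<open>Counting edges\<close>

definition incidence :: "('v::finite, 'e) pre_digraph \<Rightarrow> 'e \<Rightarrow> real^'v" where
  "incidence G e = axis (tail G e) 1 - axis (head G e) 1"

lemma inner_incidence: "incidence G e \<bullet> z = z $ tail G e - z $ head G e"
  by (simp add: incidence_def inner_diff_left inner_axis_axis inner_axis')

text \<open>Vectors orthogonal to all incidence vectors are locally constant potentials, hence
  constant, so the incidence vectors have rank at least \<open>CARD('v) - 1\<close>.\<close>

lemma card_ge_if_all_linked:
  fixes G :: "('v::finite, 'e::finite) pre_digraph"
  assumes "all_linked G A"
  shows "CARD('v) \<le> card A + 1"
proof -
  let ?K = "{z. \<forall>b\<in>incidence G ` A. b \<bullet> z = 0}"
  have "z \<in> span {\<chi> v. 1}" if "z \<in> ?K" for z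
  proof -
    have "locally_constant G A (($) z)"
      using that by (simp add: locally_constant_def inner_incidence)
    \<comment> \<open>\<open>undefined\<close> serves as an arbitrary base vertex.\<close>
    then have "z $ v = z $ undefined" for v
      using all_linkedD[OF assms] by blast
    then have "z = (z $ undefined) *\<^sub>R (\<chi> v. 1)" by (simp add: vec_eq_iff)
    then show ?thesis by (metis span_base span_scale singletonI)
  qed
  then have "dim ?K \<le> card {(\<chi> v. 1) :: real^'v}"
    by (intro dim_le_card) auto
  moreover have "dim (incidence G ` A) \<le> card A"
    using dim_le_card'[of "incidence G ` A"] card_image_le[of A "incidence G"] by simp
  ultimately show ?thesis
    using dim_orthogonal_to_set[of "incidence G ` A"] by simp
qed

text \<open>A potential that separates the ends of \<open>e\<close> but is constant along the other
  edges keeps the incidence vector of \<open>e\<close> out of the span of the others. So these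
  vectors are independent, and all are orthogonal to the all-ones vector.\<close>

lemma card_less_if_not_linked:
  fixes G :: "('v::finite, 'e::finite) pre_digraph"
  assumes "\<And>e. e \<in> A \<Longrightarrow> \<not> linked G (A - {e}) (tail G e) (head G e)"
  shows "card A < CARD('v)"
proof -
  have "\<forall>e\<in>A. incidence G e \<notin> span (incidence G ` (A - {e}))"
  proof (intro ballI notI)
    fix e assume e: "e \<in> A" "incidence G e \<in> span (incidence G ` (A - {e}))"
    obtain \<phi> where \<phi>: "locally_constant G (A - {e}) \<phi>" "\<phi> (tail G e) \<noteq> \<phi> (head G e)"
      using assms[OF e(1)] by (auto simp: linked_def)
    have "orthogonal (\<chi> v. \<phi> v) b" if "b \<in> incidence G ` (A - {e})" for b
      using that \<phi>(1) by (auto simp: orthogonal_def inner_commute[of "vec_lambda _"] inner_incidence locally_constant_def)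
    then have "orthogonal (\<chi> v. \<phi> v) (incidence G e)"
      using e(2) orthogonal_to_span by blast
    then show False
      using \<phi>(2) by (simp add: orthogonal_def inner_commute[of "vec_lambda _"] inner_incidence)
  qed
  then have ind: "inj_on (incidence G) A" "independent (incidence G ` A)"
    using independent_family_iff by blast+
  have "(\<chi> v. 1) \<in> {z. \<forall>b\<in>incidence G ` A. b \<bullet> z = 0}"
    by (simp add: inner_incidence)
  moreover have "(\<chi> v. 1) \<noteq> (0::real^'v)"
    by (simp add: vec_eq_iff)
  ultimately have "dim {z. \<forall>b\<in>incidence G ` A. b \<bullet> z = 0} > 0"
    by (metis (no_types, lifting) dim_eq_0 gr0I singletonD subsetD)
  moreover have "dim (incidence G ` A) = card A"
    using ind by (simp add: dim_eq_card_independent card_image)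
  ultimately show ?thesis
    using dim_orthogonal_to_set[of "incidence G ` A"] by simp
qed

text \<open>Deleting an edge of a cycle would preserve connectivity with fewer than
  \<open>CARD('v) - 1\<close> edges.\<close>

lemma undirected_tree_if_all_linked:
  fixes G :: "('v::finite, 'e::finite) pre_digraph"
  assumes "all_linked G A" "card A < CARD('v)" "verts G = UNIV"
  shows "undirected_tree (G\<lparr>arcs := A\<rparr>)"
  unfolding undirected_tree_def
proof (intro conjI notI)
  show "Digraph_Component.connected (G\<lparr>arcs := A\<rparr>)"
    using assms by (intro all_linked_imp_connected)
  assume "\<exists>C. undirected_cycle (G\<lparr>arcs := A\<rparr>) C"
  then obtain C where C: "undirected_cycle (G\<lparr>arcs := A\<rparr>) C" by blast
  then obtain e where e: "e \<in> C" "e \<in> A" using undirected_cycle_nonempty undirected_cycle_subset by force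
  have "all_linked G (A - {e})"
    using all_linked_Diff_edge[OF assms(1) linked_if_in_undirected_cycle[OF C e(1)]] .
  from card_ge_if_all_linked[OF this] show False
    using assms(2) e(2) card_Diff1_less[of A e] by simp
qed

text \<open>With \<open>CARD('v)\<close> edges not all can be bridges, which gives a cycle. Deleting
  any edge of a cycle leaves a tree, so that edge lies on every other cycle as well.\<close>

lemma ex1_undirected_cycle_if_all_linked:
  fixes G :: "('v::finite, 'e::finite) pre_digraph"
  assumes "all_linked G A" "card A = CARD('v)" "verts G = UNIV"
  shows "\<exists>!C. undirected_cycle (G\<lparr>arcs := A\<rparr>) C"
proof (rule ex_ex1I)
  obtain e where "e \<in> A" "linked G (A - {e}) (tail G e) (head G e)"
    using card_less_if_not_linked[of A G] assms(2) by auto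
  then show "\<exists>C. undirected_cycle (G\<lparr>arcs := A\<rparr>) C"
    using assms(3) by (rule linked_imp_undirected_cycle)
next
  have sub: "C \<subseteq> D" if C: "undirected_cycle (G\<lparr>arcs := A\<rparr>) C" and D: "undirected_cycle (G\<lparr>arcs := A\<rparr>) D" for C D
  proof
    fix e assume e: "e \<in> C"
    show "e \<in> D"
    proof (rule ccontr)
      assume "e \<notin> D"
      have "all_linked G (A - {e})"
        using all_linked_Diff_edge[OF assms(1) linked_if_in_undirected_cycle[OF C e]] .
      moreover have "card (A - {e}) < CARD('v)"
        using undirected_cycle_subset[OF C] e card_Diff1_less[of A e] by (auto simp flip: assms(2))
      ultimately have "undirected_tree (G\<lparr>arcs := A - {e}\<rparr>)"
        using assms(3) by (rule undirected_tree_if_all_linked)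
      moreover have "undirected_cycle (G\<lparr>arcs := A - {e}\<rparr>) D"
        using D \<open>e \<notin> D\<close> unfolding undirected_cycle_def joins_def by auto
      ultimately show False by (auto simp: undirected_tree_def)
    qed
  qed
  show "C = D" if "undirected_cycle (G\<lparr>arcs := A\<rparr>) C" "undirected_cycle (G\<lparr>arcs := A\<rparr>) D" for C D
    using sub[OF that] sub[OF that(2,1)] by blast
qed

lemma conn_components_connected:
  assumes "wf_digraph G" "Digraph_Component.connected G" "H \<in> conn_components G"
  shows "H = G"
proof -
  have H: "induced_subgraph H G" "\<not> verts H \<subset> verts G"
    using assms wf_digraph.induced_subgraph_refl[OF assms(1)] by (auto simp: conn_components_def)
  then have "verts H = verts G" by (auto simp: induced_subgraph_def subgraph_def)
  moreover from this H have "arcs H = arcs G"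
    using assms(1) by (auto simp: induced_subgraph_def wf_digraph_def)
  ultimately show ?thesis
    using H(1) by (auto simp: induced_subgraph_def subgraph_def compatible_def intro!: pre_digraph.equality)
qed

section \<open>The rigidity matrix\<close>

text \<open>Columns are zeroed rather than dropped, so that both parts of a row stay in one space
  and add up to the row.\<close>

definition restrict_cols :: "'c set \<Rightarrow> real^'c \<Rightarrow> real^'c" where
  "restrict_cols S z = (\<chi> c. if c \<in> S then z $ c else 0)"

text \<open>The infinitesimal motion moving each vertex by \<open>\<phi>\<close> in the \<open>k\<close>-th coordinate, with the lattice fixed.\<close>
definition coord_motion :: "2 \<Rightarrow> ('v::finite \<Rightarrow> real) \<Rightarrow> real ^ (('v \<times> 2) + unit)" where
  "coord_motion k \<phi> = (\<Sum>v\<in>UNIV. \<phi> v *\<^sub>R axis (Inl (v, k)) 1)"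

lemma inner_coord_motion: "z \<bullet> coord_motion k \<phi> = (\<Sum>v\<in>UNIV. \<phi> v * z $ Inl (v, k))"
  by (simp add: coord_motion_def inner_sum_right inner_axis)

lemma coord_motion_nth: "coord_motion k \<phi> $ Inl (v, j) = (if j = k then \<phi> v else 0)"
  by (auto simp: coord_motion_def axis_def mult_delta_right)

text \<open>The link to potentials: a row sees only the difference of \<open>\<phi>\<close> across
  its edge, so locally constant potentials give orthogonal vectors.\<close>

lemma inner_rigidity_row_coord_motion:
  "row e (rigidity_matrix y1 y2 x G m p) \<bullet> coord_motion k \<phi> =
    edge_vector y1 y2 x G m p e $ k * (\<phi> (tail G e) - \<phi> (head G e))"
proof -
  let ?d = "edge_vector y1 y2 x G m p e $ k"
  have "row e (rigidity_matrix y1 y2 x G m p) \<bullet> coord_motion k \<phi> =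
    (\<Sum>v\<in>UNIV. (if v = tail G e then \<phi> v * ?d else 0) + (if v = head G e then - \<phi> v * ?d else 0))"
    by (auto simp: inner_coord_motion row_def rigidity_matrix_def Let_def distrib_left intro!: sum.cong)
  then show ?thesis
    by (simp add: sum.distrib algebra_simps)
qed

theorem theorem3p3:
  fixes G :: "('v::finite, 'e::finite) pre_digraph"
    and m :: "'e \<Rightarrow> int^2" and p :: "'v \<Rightarrow> real^2" and x y1 y2 :: real
  assumes "verts G = UNIV" and "arcs G = UNIV"
    and "minimally_rigid_x y1 y2 x G m p"
  shows "\<exists>T M. spanning T G \<and> undirected_tree T \<and>
               spanning M G \<and> Digraph_Component.connected M \<and> map_graph M \<and>
               arcs T \<union> arcs M = arcs G \<and> arcs T \<inter> arcs M = {}"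
proof -
  let ?R = "rigidity_matrix y1 y2 x G m p"
  let ?d = "edge_vector y1 y2 x G m p"
  let ?r = "\<lambda>e. row e ?R"
  define n where "n = CARD('v)"
  have "n > 0" by (simp add: n_def)
  have card_E: "CARD('e) = 2 * n - 1" and rank: "rank ?R = 2 * n - 1"
    using assms by (simp_all add: minimally_rigid_x_def n_def)
  have rows: "rows ?R = range ?r" by (auto simp: rows_def)
  \<comment> \<open>The rank equals the number of edges, so the rows are distinct and
    independent.\<close>
  have "card (range ?r) \<ge> 2 * n - 1"
    using rank dim_le_card'[of "range ?r"] by (simp add: row_rank_def rows)
  moreover have "card (range ?r) \<le> CARD('e)" by (rule card_image_le) simp
  ultimately have card_rows: "card (range ?r) = CARD('e)" using card_E by simp
  then have inj: "inj ?r" by (intro eq_card_imp_inj_on) simp_all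
  have indep: "independent (range ?r)"
    using card_le_dim_spanning[of "range ?r" "range ?r"] rank card_rows card_E
    by (simp add: row_rank_def rows span_superset)

  \<comment> \<open>The lattice column goes to the complement of \<open>Y\<close>, so the vectors
    kept for \<open>S\<close> live in vertex columns only.\<close>
  define Y :: "(('v \<times> 2) + unit) set" where "Y = range (\<lambda>v. Inl (v, 2))"
  have split: "?r e = restrict_cols Y (?r e) + restrict_cols (- Y) (?r e)" for e
    by (simp add: restrict_cols_def vec_eq_iff)
  define w where "w S e = (if e \<in> S then restrict_cols Y (?r e) else restrict_cols (- Y) (?r e))" for S e
  have "inj (\<lambda>e. restrict_cols Y (?r e) + restrict_cols (- Y) (?r e))"
    "independent (range (\<lambda>e. restrict_cols Y (?r e) + restrict_cols (- Y) (?r e)))"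
    using inj indep unfolding split[symmetric] .
  then obtain S where w: "inj (w S)" "independent (range (w S))"
    unfolding w_def[abs_def] by (rule independent_family_choose_summand[OF finite])

  have in_Y: "Inl (v, k) \<in> Y \<longleftrightarrow> k = 2" for v k by (auto simp: Y_def)
  have inner_w: "w S e \<bullet> coord_motion k \<phi> =
      (if (e \<in> S) = (k = 2) then ?d e $ k * (\<phi> (tail G e) - \<phi> (head G e)) else 0)" for e k \<phi>
    using inner_rigidity_row_coord_motion[of e y1 y2 x G m p k \<phi>]
    by (auto simp: w_def restrict_cols_def in_Y inner_coord_motion)

  have linked: "all_linked G {e. (e \<in> S) = (k = 2)}" for k :: 2
    unfolding all_linked_def linked_def
  proof (intro allI impI)
    fix u v \<phi> assume \<phi>: "locally_constant G {e. (e \<in> S) = (k = 2)} \<phi>"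
    let ?K = "{z. \<forall>b\<in>range (w S). b \<bullet> z = 0}"
    let ?t = "\<lambda>k::2. coord_motion k (\<lambda>_::'v. 1)"
    \<comment> \<open>There are \<open>2 * n - 1\<close> independent vectors in dimension
      \<open>2 * n + 1\<close>; \<open>n > 0\<close> guards the truncated subtraction.\<close>
    have dim: "dim ?K = 2"
      using dim_orthogonal_to_set[of "range (w S)"] w card_E \<open>n > 0\<close>
      by (simp add: dim_eq_card_independent card_image n_def[symmetric])
    have t_ne: "?t 1 \<notin> span {?t 2}"
    proof
      assume "?t 1 \<in> span {?t 2}"
      then obtain a where "?t 1 = a *\<^sub>R ?t 2" by (auto simp: span_singleton)
      then have "?t 1 $ Inl (undefined, 1) = (a *\<^sub>R ?t 2) $ Inl (undefined, 1)" by simp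
      then show False by (simp add: coord_motion_nth)
    qed
    have "?t 2 \<noteq> 0"
    proof
      assume "?t 2 = 0"
      then have "?t 2 $ Inl (undefined, 2) = 0" by simp
      then show False by (simp add: coord_motion_nth)
    qed
    then have ind_t: "independent {?t 1, ?t 2}"
      using t_ne by (simp add: independent_insert)
    have "?t 1 \<noteq> ?t 2" using t_ne by (metis span_base singletonI)
    then have "card {?t 1, ?t 2} = 2" by simp
    \<comment> \<open>The translations \<open>?t 1\<close> and \<open>?t 2\<close> lie in
      \<open>?K\<close> because constant potentials have no differences; being independent, they
      span it.\<close>
    then have "?K \<subseteq> span {?t 1, ?t 2}"
      using ind_t dim by (intro card_ge_dim_independent) (auto simp: inner_w)
    moreover have "coord_motion k \<phi> \<in> ?K"
      using \<phi> by (auto simp: inner_w locally_constant_def)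
    ultimately have "coord_motion k \<phi> \<in> span {?t 1, ?t 2}" by blast
    then obtain a b where ab: "coord_motion k \<phi> = a *\<^sub>R ?t 1 + b *\<^sub>R ?t 2"
      by (auto simp: span_insert[of "?t 1"] span_singleton algebra_simps)
    have "\<phi> u' = (if k = 1 then a else b)" for u'
    proof -
      have "\<phi> u' = coord_motion k \<phi> $ Inl (u', k)" by (simp add: coord_motion_nth)
      also have "\<dots> = (if k = 1 then a else b)"
        using exhaust_2[of k] by (auto simp: ab coord_motion_nth)
      finally show ?thesis .
    qed
    then show "\<phi> u = \<phi> v" by simp
  qed
  have T: "all_linked G S" using linked[of 2] by simp
  have M: "all_linked G (- S)" using linked[of 1] by (simp add: Compl_eq)

  have "card S < CARD('v)"
  proof (rule card_less_if_not_linked)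
    fix e assume e: "e \<in> S"
    have w_notin: "\<forall>e\<in>UNIV. w S e \<notin> span (w S ` (UNIV - {e}))"
      using w independent_family_iff[of "w S" UNIV] by simp
    obtain z where z: "\<And>b. b \<in> w S ` (UNIV - {e}) \<Longrightarrow> b \<bullet> z = 0" "w S e \<bullet> z \<noteq> 0"
      using exists_orthogonal_if_notin_span w_notin by blast
    \<comment> \<open>For \<open>f \<in> S\<close> the vector is supported on \<open>Y\<close>, so
      only the second coordinates of \<open>z\<close> matter.\<close>
    have inner_z: "w S f \<bullet> z = ?d f $ 2 * (z $ Inl (tail G f, 2) - z $ Inl (head G f, 2))" if "f \<in> S" for f z
    proof -
      have "w S f \<bullet> z = w S f \<bullet> coord_motion 2 (\<lambda>v. z $ Inl (v, 2))"
        using that by (auto simp: w_def inner_vec_def restrict_cols_def Y_def coord_motion_nth intro!: sum.cong)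
      then show ?thesis using that by (simp add: inner_w)
    qed
    have d_ne: "?d f $ 2 \<noteq> 0" if "f \<in> S" for f
    proof
      assume "?d f $ 2 = 0"
      \<comment> \<open>Pairing \<open>w S f\<close> with itself gives norm zero, while a zero
        vector cannot belong to an independent family.\<close>
      then have "w S f = 0" using inner_z[OF that, of "w S f"] by simp
      then show False
        using w_notin[rule_format, of f] span_zero[of "w S ` (UNIV - {f})"] by simp
    qed
    \<comment> \<open>The second coordinates of \<open>z\<close> form a potential witnessing that
      \<open>e\<close> is a bridge of \<open>S\<close>.\<close>
    have "locally_constant G (S - {e}) (\<lambda>v. z $ Inl (v, 2))"
      unfolding locally_constant_def
    proof
      fix f assume f: "f \<in> S - {e}"
      then have "w S f \<bullet> z = 0" by (intro z(1)) auto
      then show "z $ Inl (tail G f, 2) = z $ Inl (head G f, 2)"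
        using inner_z[of f z] d_ne[of f] f by simp
    qed
    moreover have "z $ Inl (tail G e, 2) \<noteq> z $ Inl (head G e, 2)"
      using z(2) inner_z[OF e] by auto
    ultimately show "\<not> linked G (S - {e}) (tail G e) (head G e)"
      unfolding linked_def by blast
  qed
  moreover have "card S + card (- S) = CARD('e)"
    by (metis Compl_disjoint Compl_partition card_Un_disjoint finite)
  \<comment> \<open>Connectivity of \<open>S\<close> gives the reverse bound, so \<open>S\<close>
    has \<open>n - 1\<close> of the \<open>2 * n - 1\<close> edges.\<close>
  ultimately have card_M: "card (- S) = CARD('v)"
    using card_ge_if_all_linked[OF T] card_E by (simp add: n_def)

  let ?T = "G\<lparr>arcs := S\<rparr>" and ?M = "G\<lparr>arcs := - S\<rparr>"
  have wf: "wf_digraph (G\<lparr>arcs := A\<rparr>)" "wf_digraph G" for A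
    using assms(1) by (simp_all add: wf_digraph_def)
  have spanning: "spanning (G\<lparr>arcs := A\<rparr>) G" for A
    using wf assms(2) by (simp add: spanning_def subgraph_def compatible_def)
  have conn: "Digraph_Component.connected ?M"
    using M assms(1) by (rule all_linked_imp_connected)
  have "map_graph ?M"
    unfolding map_graph_def
    using ex1_undirected_cycle_if_all_linked[OF M card_M assms(1)] conn_components_connected[OF wf(1) conn]
    by metis
  moreover have "undirected_tree ?T"
    using T \<open>card S < CARD('v)\<close> assms(1) by (rule undirected_tree_if_all_linked)
  ultimately show ?thesis
    using spanning conn assms(2) by (intro exI[of _ ?T] exI[of _ ?M]) auto
qed

end
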